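(* Let $\mathcal{F}\subset\{0,1\}^{n}$, let $\mathbb{F}$ be a field, and regard the elements of $\mathcal{F}$ as vectors in $\mathbb{F}^n$. Suppose that $\dim\langle \mathcal{F} \rangle = d$ and $\dim \langle \mathcal{F}\cdot \mathcal{F} \rangle=d+h$. Then $[n]$ can be partitioned into $d+1$ sets $A_1,\dots,A_d,B$ such that $A_{i}$ is a maximal set of twins for $\mathcal{F}$ for each $i\in [d]$, and $\dim \langle \mathcal{F}|_{B} \rangle \leq 2h$.
   Context: $\langle\cdot\rangle$ denotes the linear span over $\mathbb{F}$. For $v,w\in\mathbb{F}^n$, $v\cdot w$ is the coordinatewise product, $(v\cdot w)(i)=v(i)w(i)$, and $\mathcal{F}\cdot\mathcal{F}=\{v\cdot w: v,w\in\mathcal{F}\}$ (for 0-1 vectors this corresponds to intersections of sets). For $B\subset[n]$, $\mathcal{F}|_B=\{v|_B: v\in\mathcal{F}\}$, where $v|_B\in\mathbb{F}^B$ is the restriction of $v$ to the coordinates in $B$. Two indices $i,j\in[n]$ are twins for $\mathcal{F}$ if $v(i)=v(j)$ for every $v\in\mathcal{F}$ and $v(i)\neq 0$ for at least one $v\in\mathcal{F}$. Being twins (together with $i\sim i$ whenever $v(i)\ne0$ for some $v\in\mathcal{F}$) is an equivalence relation on the set of indices $i$ with $v(i)\neq 0$ for some $v\in\mathcal{F}$; a maximal set of twins is a full equivalence class of this relation. *)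

theory Defs
  imports "HOL-Analysis.Cartesian_Space" "HOL-Library.Disjoint_Sets"
begin

text \<open>The index set \<open>[n]\<close> is a finite type \<open>'n\<close>, so the vectors are of type \<open>'a ^ 'n\<close>, whose
  multiplication \<open>*\<close> is coordinatewise.\<close>

definition coord_products :: "('a::field ^ 'n) set \<Rightarrow> ('a ^ 'n) set" where
  "coord_products F = {v * w | v w. v \<in> F \<and> w \<in> F}"

text \<open>The space of vectors indexed by \<open>B\<close> is identified with the vectors that vanish outside
  \<open>B\<close>, via the linear isomorphism extending by zero.\<close>

definition restrict_coords :: "'n set \<Rightarrow> 'a::field ^ 'n \<Rightarrow> 'a ^ 'n" where
  "restrict_coords B v = (\<chi> i. if i \<in> B then v $ i else 0)"

definition support_indices :: "('a::field ^ 'n) set \<Rightarrow> 'n set" where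
  "support_indices F = {i. \<exists>v\<in>F. v $ i \<noteq> 0}"

text \<open>On the diagonal this holds exactly for the indices in \<^term>\<open>support_indices F\<close>.\<close>

definition twins :: "('a::field ^ 'n) set \<Rightarrow> 'n \<Rightarrow> 'n \<Rightarrow> bool" where
  "twins F i j \<longleftrightarrow> (\<forall>v\<in>F. v $ i = v $ j) \<and> (\<exists>v\<in>F. v $ i \<noteq> 0)"

lemma equiv_twins: "equiv (support_indices F) {(i, j). twins F i j}"
  by (rule equivI) (auto simp: refl_on_def sym_def trans_def support_indices_def twins_def)

definition maximal_twin_set :: "('a::field ^ 'n) set \<Rightarrow> 'n set \<Rightarrow> bool" where
  "maximal_twin_set F A \<longleftrightarrow> A \<in> support_indices F // {(i, j). twins F i j}"

end

theory Submission imports Defs begin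

text \<open>Choose a minimal set \<open>I\<close> of indices on which restriction is injective on the span \<open>V\<close> of \<open>F\<close>. It
  has \<open>d\<close> elements and carries a dual basis \<open>u x\<close> of \<open>V\<close>; the sets \<open>A\<close> are the twin classes of its
  elements. The products \<open>u x * u x'\<close> with \<open>x \<noteq> x'\<close> vanish on \<open>I\<close>, so their span meets \<open>V\<close> trivially
  and has dimension at most \<open>h\<close>. At every index of \<open>B\<close> either no \<open>u x\<close> or at least two of them are
  nonzero, and this forces the rank of \<open>V\<close> on \<open>B\<close> to be at most twice that of these products.\<close>

lemma linear_coord_mult: "Vector_Spaces.linear (*s) (*s) ((*) (g :: 'a::field ^ 'n))"
  by unfold_locales (vector algebra_simps)+

lemma restrict_coords_eq_mult:
  "restrict_coords C v = (\<chi> i. of_bool (i \<in> C)) * (v :: 'a::field ^ 'n)"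
  by (auto simp: restrict_coords_def vec_eq_iff)

lemma restrict_coords_nth [simp]:
  "restrict_coords C v $ i = (if i \<in> C then v $ i else 0)"
  by (simp add: restrict_coords_def)

lemma linear_restrict_coords:
  "Vector_Spaces.linear (*s) (*s) (restrict_coords C :: 'a::field ^ 'n \<Rightarrow> _)"
  unfolding restrict_coords_eq_mult[abs_def] by (rule linear_coord_mult)

lemma dim_le_dim_sum:
  fixes S T U :: "('a::field ^ 'n) set"
  assumes "\<And>x. x \<in> S \<Longrightarrow> \<exists>y\<in>vec.span T. \<exists>z\<in>vec.span U. x = y + z"
  shows "vec.dim S \<le> vec.dim T + vec.dim U"
proof -
  have "S \<subseteq> {y + z |y z. y \<in> vec.span T \<and> z \<in> vec.span U}"
    using assms by blast
  then have "vec.dim S \<le> vec.dim {y + z |y z. y \<in> vec.span T \<and> z \<in> vec.span U}"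
    by (rule vec.dim_subset)
  also have "\<dots> \<le> vec.dim T + vec.dim U"
    using vec.dim_sums_Int[of "vec.span T" "vec.span U"] by simp
  finally show ?thesis .
qed

text \<open>Rank-nullity for a part \<open>T\<close> of the kernel: a basis of \<open>T\<close> is
  extended to one of \<open>vec.span S\<close>. As \<open>f\<close> kills the basis of
  \<open>T\<close>, the images of the other basis vectors already generate the image of
  \<open>S\<close>.\<close>

lemma dim_image_plus_dim_kernel_le:
  fixes f :: "'a::field ^ 'n \<Rightarrow> 'a ^ 'm"
  assumes f: "Vector_Spaces.linear (*s) (*s) f"
    and TS: "T \<subseteq> vec.span S" and ker: "\<And>x. x \<in> T \<Longrightarrow> f x = 0"
  shows "vec.dim (f ` S) + vec.dim T \<le> vec.dim S"
proof -
  interpret f: Vector_Spaces.linear "(*s)" "(*s)" f by fact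
  obtain B where B: "B \<subseteq> T" "vec.independent B" "T \<subseteq> vec.span B" "card B = vec.dim T"
    using vec.basis_exists by blast
  obtain C where C: "B \<subseteq> C" "C \<subseteq> vec.span S" "vec.independent C" "vec.span S \<subseteq> vec.span C"
    using vec.maximal_independent_subset_extend[of B "vec.span S"] B TS by blast
  have finC: "finite C"
    using C(3) by (rule vec.finiteI_independent)
  have cardC: "card C = vec.dim S"
    using vec.basis_card_eq_dim[of C "vec.span S"] C by simp
  have "f ` S \<subseteq> vec.span (f ` (C - B))"
  proof -
    have "f ` S \<subseteq> vec.span (f ` C)"
      using C(4) vec.span_superset[of S] by (auto simp: f.span_image)
    also have "\<dots> \<subseteq> vec.span (f ` (C - B))"
    proof (rule vec.span_minimal)
      show "f ` C \<subseteq> vec.span (f ` (C - B))"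
      proof (rule image_subsetI)
        fix x assume "x \<in> C"
        show "f x \<in> vec.span (f ` (C - B))"
        proof (cases "x \<in> B")
          case True
          then have "f x = 0" using ker B(1) by blast
          then show ?thesis by (simp add: vec.span_zero)
        next
          case False
          then show ?thesis using \<open>x \<in> C\<close> by (intro vec.span_base) blast
        qed
      qed
    qed (rule vec.subspace_span)
    finally show ?thesis .
  qed
  then have "vec.dim (f ` S) \<le> card (f ` (C - B))"
    using finC by (intro vec.dim_le_card) auto
  also have "\<dots> \<le> card (C - B)"
    using finC by (intro card_image_le) auto
  also have "\<dots> = card C - card B"
    using C(1) finC by (intro card_Diff_subset) (auto intro: finite_subset)
  finally show ?thesis
    using card_mono[OF finC C(1)] B(4) cardC by simp
qed

text \<open>Peel off the coordinates where one fixed \<^term>\<open>u x\<close> is nonzero. There multiplication by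
  \<^term>\<open>u x\<close> is invertible, so the products \<^term>\<open>u x * u x'\<close> lose at most one dimension, and they
  still have rank at least 1: hence their rank \<open>k\<close> satisfies \<open>1 + k \<le> 2 k\<close>.\<close>

lemma dim_restrict_le_twice_dim_products:
  fixes u :: "'k \<Rightarrow> 'a::field ^ 'n::finite"
  assumes "\<And>y x. y \<in> C \<Longrightarrow> x \<in> I \<Longrightarrow> u x $ y \<noteq> 0 \<Longrightarrow> \<exists>x'\<in>I. x' \<noteq> x \<and> u x' $ y \<noteq> 0"
  shows "vec.dim (restrict_coords C ` u ` I)
    \<le> 2 * vec.dim (restrict_coords C ` {u x * u x' |x x'. x \<in> I \<and> x' \<in> I \<and> x \<noteq> x'})"
  using finite[of C] assms
proof (induction C rule: finite_psubset_induct)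
  case (psubset C)
  let ?Q = "{u x * u x' |x x'. x \<in> I \<and> x' \<in> I \<and> x \<noteq> x'}"
  show ?case
  proof (cases "\<exists>x\<in>I. \<exists>y\<in>C. u x $ y \<noteq> 0")
    case False
    then have "restrict_coords C ` u ` I \<subseteq> {0}"
      by (auto simp: vec_eq_iff)
    then have "vec.dim (restrict_coords C ` u ` I) = 0"
      by simp
    then show ?thesis by linarith
  next
    case True
    then obtain x y where xy: "x \<in> I" "y \<in> C" "u x $ y \<noteq> 0" by blast
    define C' where "C' = {y \<in> C. u x $ y = 0}"
    define D where "D = C - C'"
    define E where "E = restrict_coords C ` (\<lambda>x'. u x * u x') ` (I - {x})"
    have "C' \<subset> C" using xy by (auto simp: C'_def)
    \<comment> \<open>The hypothesis concerns each index of \<open>C\<close> separately, so the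
      subset \<open>C'\<close> inherits it.\<close>
    then have IH: "vec.dim (restrict_coords C' ` u ` I) \<le> 2 * vec.dim (restrict_coords C' ` ?Q)"
      using psubset.prems by (intro psubset.IH) blast+
    have split: "vec.dim (restrict_coords C ` u ` I)
        \<le> vec.dim (restrict_coords C' ` u ` I) + vec.dim (restrict_coords D ` u ` I)"
    proof (rule dim_le_dim_sum)
      fix w assume "w \<in> restrict_coords C ` u ` I"
      then obtain z where z: "z \<in> I" "w = restrict_coords C (u z)" by blast
      have "w = restrict_coords C' (u z) + restrict_coords D (u z)"
        using \<open>C' \<subset> C\<close> by (auto simp: vec_eq_iff z D_def)
      then show "\<exists>y\<in>vec.span (restrict_coords C' ` u ` I).
          \<exists>z\<in>vec.span (restrict_coords D ` u ` I). w = y + z"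
        using z(1) by (blast intro: vec.span_base)
    qed
    have D_le: "vec.dim (restrict_coords D ` u ` I) \<le> 1 + vec.dim E"
    proof -
      \<comment> \<open>Since \<open>inverse 0 = 0\<close>, multiplication by \<open>?g\<close>
        cancels the factor \<open>u x\<close> on \<open>D\<close> and at the same time erases the
        coordinates in \<open>C'\<close>.\<close>
      let ?g = "\<chi> i. inverse (u x $ i)"
      have "restrict_coords D (u z) = ?g * restrict_coords C (u x * u z)" for z
        by (auto simp: vec_eq_iff D_def C'_def)
      then have eq: "restrict_coords D ` u ` (I - {x}) = (*) ?g ` E"
        by (simp add: E_def image_image)
      \<comment> \<open>\<open>E\<close> is built from the \<open>x' \<noteq> x\<close> only, so
        \<open>u x\<close> itself accounts for the extra 1.\<close>
      have "restrict_coords D ` u ` I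
          \<subseteq> insert (restrict_coords D (u x)) (restrict_coords D ` u ` (I - {x}))"
        by auto
      then have "vec.dim (restrict_coords D ` u ` I)
          \<le> vec.dim (insert (restrict_coords D (u x)) (restrict_coords D ` u ` (I - {x})))"
        by (rule vec.dim_subset)
      also have "\<dots> \<le> 1 + vec.dim ((*) ?g ` E)"
        unfolding eq by (simp add: vec.dim_insert)
      also have "vec.dim ((*) ?g ` E) \<le> vec.dim E"
        by (rule vec.dim_image_le[OF linear_coord_mult])
      finally show ?thesis by simp
    qed
    have E_pos: "1 \<le> vec.dim E"
    proof -
      obtain x' where x': "x' \<in> I" "x' \<noteq> x" "u x' $ y \<noteq> 0"
        using psubset.prems xy by blast
      then have "restrict_coords C (u x * u x') \<in> E" by (auto simp: E_def)
      moreover have "restrict_coords C (u x * u x') \<noteq> 0"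
        using xy x' by (auto simp: vec_eq_iff intro!: exI[of _ y])
      ultimately have "\<not> E \<subseteq> {0}" by blast
      then show ?thesis by (metis vec.dim_eq_0 less_one linorder_not_le)
    qed
    \<comment> \<open>All members of \<open>E\<close> carry the factor \<open>u x\<close>, which
      vanishes on \<open>C'\<close>; restriction to \<open>C'\<close> therefore kills
      \<open>E\<close>, and the products lose at least \<open>vec.dim E\<close> of their
      rank.\<close>
    have "vec.dim (restrict_coords C' ` restrict_coords C ` ?Q) + vec.dim E
        \<le> vec.dim (restrict_coords C ` ?Q)"
    proof (rule dim_image_plus_dim_kernel_le[OF linear_restrict_coords])
      show "E \<subseteq> vec.span (restrict_coords C ` ?Q)"
        unfolding E_def using xy(1) by (intro order.trans[OF _ vec.span_superset]) blast
      show "restrict_coords C' w = 0" if "w \<in> E" for w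
        using that by (auto simp: E_def vec_eq_iff C'_def)
    qed
    moreover have "restrict_coords C' ` restrict_coords C ` ?Q = restrict_coords C' ` ?Q"
    proof -
      have "restrict_coords C' (restrict_coords C w) = restrict_coords C' w" for w :: "'a ^ 'n"
        using \<open>C' \<subset> C\<close> by (auto simp: vec_eq_iff)
      then show ?thesis by (simp add: image_image)
    qed
    \<comment> \<open>The part on \<open>D\<close> costs at most
      \<open>1 + vec.dim E \<le> 2 * vec.dim E\<close>, and the part on \<open>C'\<close> is bounded
      by induction; the two product ranks add up to at most the one on \<open>C\<close>.\<close>
    ultimately show ?thesis using IH split D_le E_pos by simp
  qed
qed

text \<open>Take \<open>I\<close> minimal among the index sets on which only the zero vector of
  \<open>V\<close> vanishes. Minimality yields the vectors \<open>u x\<close>, and vanishing on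
  \<open>I\<close> forcing zero yields the expansion.\<close>

lemma ex_dual_basis:
  fixes V :: "('a::field ^ 'n::finite) set"
  assumes V: "vec.subspace V"
  obtains I u where "\<And>x. x \<in> I \<Longrightarrow> u x \<in> V"
    and "\<And>x x'. x \<in> I \<Longrightarrow> x' \<in> I \<Longrightarrow> u x $ x' = of_bool (x = x')"
    and "\<And>v. v \<in> V \<Longrightarrow> v = (\<Sum>x\<in>I. v $ x *s u x)"
    and "card I = vec.dim V"
proof -
  define P where "P I \<longleftrightarrow> (\<forall>v\<in>V. (\<forall>i\<in>I. v $ i = 0) \<longrightarrow> v = 0)" for I
  have "P UNIV" by (auto simp: P_def vec_eq_iff)
  then obtain I where I: "P I" "\<And>J. J \<subset> I \<Longrightarrow> \<not> P J"
    using finite_has_minimal[of "Collect P"]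
    by (metis (mono_tags, lifting) empty_iff finite mem_Collect_eq order_less_imp_le psubset_eq)
  have "\<exists>w\<in>V. \<forall>x'\<in>I. w $ x' = of_bool (x = x')" if x: "x \<in> I" for x
  proof -
    \<comment> \<open>Without \<open>x\<close> the set no longer determines the vectors of
      \<open>V\<close>; a witness is nonzero at \<open>x\<close> and only has to be
      rescaled.\<close>
    obtain v where v: "v \<in> V" "\<forall>i\<in>I - {x}. v $ i = 0" "v \<noteq> 0"
      using I(2)[of "I - {x}"] x by (auto simp: P_def)
    then have "v $ x \<noteq> 0" using I(1) by (auto simp: P_def)
    then show ?thesis
      using v V by (intro bexI[of _ "inverse (v $ x) *s v"]) (auto intro: vec.subspace_scale)
  qed
  then obtain u where u: "\<And>x. x \<in> I \<Longrightarrow> u x \<in> V"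
    "\<And>x x'. x \<in> I \<Longrightarrow> x' \<in> I \<Longrightarrow> u x $ x' = of_bool (x = x')"
    by metis
  have eval: "(\<Sum>x\<in>I. c x *s u x) $ x' = c x'" if "x' \<in> I" for c x'
  proof -
    have "(\<Sum>x\<in>I. c x *s u x) $ x' = (\<Sum>x\<in>I. if x = x' then c x' else 0)"
      using that u(2) by (auto intro!: sum.cong)
    then show ?thesis using that by simp
  qed
  have expand: "v = (\<Sum>x\<in>I. v $ x *s u x)" if v: "v \<in> V" for v
  proof -
    \<comment> \<open>The difference lies in \<open>V\<close> and vanishes on \<open>I\<close>,
      hence is zero.\<close>
    have "v - (\<Sum>x\<in>I. v $ x *s u x) \<in> V"
      using V v u(1) by (intro vec.subspace_diff vec.subspace_sum vec.subspace_scale) auto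
    moreover have "(v - (\<Sum>x\<in>I. v $ x *s u x)) $ i = 0" if "i \<in> I" for i
      using eval[OF that, of "\<lambda>x. v $ x"] by simp
    ultimately have "v - (\<Sum>x\<in>I. v $ x *s u x) = 0" using I(1) unfolding P_def by blast
    then show ?thesis by (rule eq_iff_diff_eq_0[THEN iffD2])
  qed
  have inj: "inj_on u I"
    by (rule inj_onI) (metis (mono_tags) u(2) of_bool_eq_iff)
  have "vec.independent (u ` I)"
  proof (rule vec.independent_if_scalars_zero)
    fix f w assume 0: "(\<Sum>x\<in>u ` I. f x *s x) = 0" and w: "w \<in> u ` I"
    obtain x where x: "x \<in> I" "w = u x" using w by blast
    have "(\<Sum>x\<in>I. f (u x) *s u x) $ x = 0"
      using 0 by (simp add: sum.reindex[OF inj])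
    then show "f w = 0" using eval[OF x(1), of "\<lambda>x. f (u x)"] x by simp
  qed simp
  moreover have "V \<subseteq> vec.span (u ` I)"
  proof
    fix v assume "v \<in> V"
    then have "v = (\<Sum>x\<in>I. v $ x *s u x)" by (rule expand)
    also have "\<dots> \<in> vec.span (u ` I)"
      by (intro vec.span_sum vec.span_scale vec.span_base) auto
    finally show "v \<in> vec.span (u ` I)" .
  qed
  ultimately have "card I = vec.dim V"
    using vec.basis_card_eq_dim[of "u ` I" V] u(1) card_image[OF inj] by auto
  then show thesis using that u expand by blast
qed

text \<open>By bilinearity: with one factor fixed, the admissible other factors form a subspace.
  This is applied first with a fixed factor in \<open>F\<close>, then with one in the span.\<close>

lemma mult_mem_span_coord_products:
  fixes F :: "('a::field ^ 'n) set"
  assumes v: "v \<in> vec.span F" and w: "w \<in> vec.span F"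
  shows "v * w \<in> vec.span (coord_products F)"
proof -
  have sp: "vec.subspace {z. a * z \<in> vec.span (coord_products F)}" for a :: "'a ^ 'n"
  proof (rule vec.subspaceI)
    have "a * (c *s z) = c *s (a * z)" for c z
      by (simp add: vec_eq_iff)
    then show "c *s z \<in> {z. a * z \<in> vec.span (coord_products F)}"
      if "z \<in> {z. a * z \<in> vec.span (coord_products F)}" for c z
      using that by (simp add: vec.span_scale)
  qed (auto simp: distrib_left vec.span_zero vec.span_add)
  have "b * a \<in> vec.span (coord_products F)" if "b \<in> F" "a \<in> vec.span F" for a b
    using vec.span_minimal[OF _ sp[of b], of F] that
    by (auto simp: coord_products_def intro: vec.span_base)
  then show ?thesis
    using vec.span_minimal[OF _ sp[of w], of F] v w by (auto simp: mult.commute)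
qed

lemma twins_span:
  assumes "twins F i j" "v \<in> vec.span F"
  shows "v $ i = v $ j"
  using assms(2)
  by (induction rule: vec.span_induct_alt) (use assms(1) in \<open>auto simp: twins_def\<close>)

lemma span_nth_nonzero_imp_mem_support:
  assumes "v \<in> vec.span F" "v $ i \<noteq> 0"
  shows "i \<in> support_indices F"
proof (rule ccontr)
  assume "i \<notin> support_indices F"
  then have "\<And>w. w \<in> F \<Longrightarrow> w $ i = 0" by (auto simp: support_indices_def)
  with assms(1) have "v $ i = 0"
    by (induction rule: vec.span_induct_alt) auto
  with assms(2) show False by simp
qed

theorem theorem1p3:
  fixes F :: "('a::field ^ 'n::finite) set" and d h :: nat
  assumes "\<forall>v\<in>F. \<forall>i. v $ i \<in> {0, 1}"
    and "vec.dim (vec.span F) = d"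
    and "vec.dim (vec.span (coord_products F)) = d + h"
  shows "\<exists>(A :: nat \<Rightarrow> 'n set) B.
      (\<Union>i\<in>{1..d}. A i) \<union> B = UNIV
    \<and> disjoint_family_on A {1..d}
    \<and> (\<forall>i\<in>{1..d}. A i \<inter> B = {})
    \<and> (\<forall>i\<in>{1..d}. maximal_twin_set F (A i))
    \<and> vec.dim (vec.span (restrict_coords B ` F)) \<le> 2 * h"
proof -
  obtain I u where uV: "\<And>x. x \<in> I \<Longrightarrow> u x \<in> vec.span F"
    and u: "\<And>x x'. x \<in> I \<Longrightarrow> x' \<in> I \<Longrightarrow> u x $ x' = of_bool (x = x')"
    and expand: "\<And>v. v \<in> vec.span F \<Longrightarrow> v = (\<Sum>x\<in>I. v $ x *s u x)"
    and "card I = vec.dim (vec.span F)"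
    by (rule ex_dual_basis[OF vec.subspace_span[of F]]) (rule that)
  with assms(2) have cardI: "card I = d" by simp
  then obtain p where p: "bij_betw p {1..d} I"
    using ex_bij_betw_nat_finite_1[OF finite[of I]] by blast
  have pI: "p i \<in> I" if "i \<in> {1..d}" for i
    using p that by (auto simp: bij_betw_def)
  define A where "A i = {j. twins F (p i) j}" for i
  define B where "B = - (\<Union>i\<in>{1..d}. A i)"
  define Q where "Q = {u x * u x' |x x'. x \<in> I \<and> x' \<in> I \<and> x \<noteq> x'}"
  have disj: "disjoint_family_on A {1..d}"
  proof -
    have "i = j" if ij: "i \<in> {1..d}" "j \<in> {1..d}" and k: "k \<in> A i" "k \<in> A j" for i j k
    proof -
      \<comment> \<open>A common twin \<open>k\<close> would make \<open>u (p i)\<close> agree at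
        \<open>p i\<close> and \<open>p j\<close>, but it is 1 at the first and 0 at any other
        element of \<open>I\<close>.\<close>
      have "u (p i) $ p j = u (p i) $ p i"
        using twins_span[of F _ k "u (p i)"] k uV[OF pI[OF ij(1)]] by (simp add: A_def)
      then have "p i = p j" by (simp add: u pI[OF ij(1)] pI[OF ij(2)])
      then show ?thesis using inj_onD[OF bij_betw_imp_inj_on[OF p]] ij by blast
    qed
    then show ?thesis by (auto simp: disjoint_family_on_def)
  qed
  have maxi: "maximal_twin_set F (A i)" if "i \<in> {1..d}" for i
  proof -
    have "p i \<in> support_indices F"
      using span_nth_nonzero_imp_mem_support[OF uV[OF pI[OF that]], of "p i"]
      by (simp add: u pI[OF that])
    then show ?thesis
      unfolding maximal_twin_set_def A_def quotient_def by auto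
  qed
  text \<open>If \<^term>\<open>u x\<close> were the only one nonzero at \<open>y\<close>, then \<open>v $ y = v $ x * u x $ y\<close> on the
    span; as the vectors are 0-1 valued this makes \<open>y\<close> a twin of \<open>x\<close>.\<close>
  have two: "\<exists>x'\<in>I. x' \<noteq> x \<and> u x' $ y \<noteq> 0"
    if y: "y \<in> B" and x: "x \<in> I" and ne: "u x $ y \<noteq> 0" for x y
  proof (rule ccontr)
    assume "\<not> (\<exists>x'\<in>I. x' \<noteq> x \<and> u x' $ y \<noteq> 0)"
    then have z: "u x' $ y = 0" if "x' \<in> I" "x' \<noteq> x" for x' using that by blast
    have ev: "v $ y = v $ x * u x $ y" if "v \<in> vec.span F" for v
    proof -
      have "v $ y = (\<Sum>x'\<in>I. v $ x' * u x' $ y)"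
        by (subst expand[OF that]) simp
      also have "\<dots> = (\<Sum>x'\<in>I. if x' = x then v $ x * u x $ y else 0)"
        by (rule sum.cong[OF refl]) (simp add: z)
      finally show ?thesis using x by simp
    qed
    have "y \<in> support_indices F"
      using span_nth_nonzero_imp_mem_support[OF uV[OF x] ne] .
    then obtain v where v: "v \<in> F" "v $ y \<noteq> 0" by (auto simp: support_indices_def)
    then have "v $ x \<noteq> 0" using ev[OF vec.span_base] by auto
    then have "u x $ y = 1"
      using ev[OF vec.span_base[OF v(1)]] v assms(1) by (metis insertE singletonD mult_1)
    then have "twins F x y"
      using ev[OF vec.span_base] v \<open>v $ x \<noteq> 0\<close> by (auto simp: twins_def)
    moreover obtain i where "i \<in> {1..d}" "x = p i"
      using x p by (auto simp: bij_betw_def)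
    ultimately show False using y by (auto simp: A_def B_def)
  qed
  have Qle: "vec.dim Q \<le> h"
  proof -
    have Q0: "q $ x = 0" if "q \<in> vec.span Q" "x \<in> I" for q x
      using that(1) by (induction rule: vec.span_induct_alt) (auto simp: Q_def u that(2))
    have "vec.span F \<inter> vec.span Q \<subseteq> {0}"
    proof
      fix v assume v: "v \<in> vec.span F \<inter> vec.span Q"
      then have "v = (\<Sum>x\<in>I. v $ x *s u x)" using expand by blast
      also have "\<dots> = 0" using Q0 v by simp
      finally show "v \<in> {0}" by simp
    qed
    then have "vec.dim (vec.span F \<inter> vec.span Q) = 0" by simp
    \<comment> \<open>The sum is direct, so dimensions add; it lies in a space of dimension
      \<open>d + h\<close>, which leaves at most \<open>h\<close> for \<open>Q\<close>.\<close>
    then have "vec.dim {x + y |x y. x \<in> vec.span F \<and> y \<in> vec.span Q} = d + vec.dim Q"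
      using vec.dim_sums_Int[of "vec.span F" "vec.span Q"] assms(2)
      by (simp del: vec.dim_eq_0)
    moreover have sub: "{x + y |x y. x \<in> vec.span F \<and> y \<in> vec.span Q} \<subseteq> vec.span (coord_products F)"
    proof -
      have "v \<in> vec.span (coord_products F)" if "v \<in> F" for v
      proof -
        \<comment> \<open>0-1 vectors are idempotent, so \<open>F\<close> consists of products of
          its own members.\<close>
        have "v = v * v" using assms(1) that by (force simp: vec_eq_iff)
        then show ?thesis using mult_mem_span_coord_products vec.span_base that by metis
      qed
      then have "vec.span F \<subseteq> vec.span (coord_products F)"
        by (intro vec.span_minimal) auto
      moreover have "vec.span Q \<subseteq> vec.span (coord_products F)"
        by (intro vec.span_minimal) (auto simp: Q_def uV mult_mem_span_coord_products)
      ultimately show ?thesis by (auto intro: vec.span_add)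
    qed
    ultimately have "d + vec.dim Q \<le> d + h"
      using vec.dim_subset[OF sub] assms(3) by simp
    then show ?thesis by simp
  qed
  \<comment> \<open>The rank bound is about the dual basis, so \<open>F\<close> is first replaced by
    it.\<close>
  have "restrict_coords B ` F \<subseteq> vec.span (restrict_coords B ` u ` I)"
  proof -
    have "F \<subseteq> vec.span (u ` I)"
    proof
      fix v assume "v \<in> F"
      then have "v = (\<Sum>x\<in>I. v $ x *s u x)" using expand vec.span_base by blast
      also have "\<dots> \<in> vec.span (u ` I)"
        by (intro vec.span_sum vec.span_scale vec.span_base) auto
      finally show "v \<in> vec.span (u ` I)" .
    qed
    then show ?thesis
      by (auto simp: vec.linear_span_image[OF linear_restrict_coords])
  qed
  then have "vec.dim (restrict_coords B ` F) \<le> vec.dim (restrict_coords B ` u ` I)"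
    by (rule vec.dim_mono)
  also have "\<dots> \<le> 2 * vec.dim (restrict_coords B ` Q)"
    unfolding Q_def by (rule dim_restrict_le_twice_dim_products) (rule two)
  also have "vec.dim (restrict_coords B ` Q) \<le> vec.dim Q"
    by (rule vec.dim_image_le[OF linear_restrict_coords])
  also note Qle
  finally have "vec.dim (vec.span (restrict_coords B ` F)) \<le> 2 * h" by simp
  with disj maxi show ?thesis
    by (intro exI[of _ A] exI[of _ B]) (auto simp: B_def)
qed

end
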